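(* Let $n\ge 5$ and let $p_n(x)=\det(xI-C)$ be the characteristic polynomial of the $n\times n$ affine Cartan matrix $C$ of type $D_{n-1}^{(1)}$. Then $$p_n(x)=x(x-2)^2(x-4)\sum_{j=0}^{n-4}(-1)^{n+j}\binom{n+j-3}{2j+1}x^j .$$
   Context: The $n\times n$ matrix $C=(C_{i,j})_{1\le i,j\le n}$ of type $D_{n-1}^{(1)}$ has $C_{i,i}=2$ for all $i$, $C_{1,3}=C_{3,1}=-1$, $C_{i,i+1}=C_{i+1,i}=-1$ for $2\le i\le n-2$, $C_{n-2,n}=C_{n,n-2}=-1$, and all other entries $0$. *)

theory Defs
  imports "Jordan_Normal_Form.Char_Poly"
begin

text \<open>
  The entry in row \<open>i\<close>, column \<open>j\<close> of the \<open>n \<times> n\<close> affine Cartan matrix of type \<open>D\<^sub>n\<^sub>-\<^sub>1\<^sup>(\<^sup>1\<^sup>)\<close>,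
  with \<open>i\<close> and \<open>j\<close> counted from 1 to \<open>n\<close>. Each doubleton equation lists an edge of the Dynkin
  diagram in both orientations.
\<close>

definition affine_cartan_D_entry :: "nat \<Rightarrow> nat \<Rightarrow> nat \<Rightarrow> int" where
  "affine_cartan_D_entry n i j =
     (if i = j then 2
      else if {i, j} = {1, 3} \<or> (\<exists>k. 2 \<le> k \<and> k \<le> n - 2 \<and> {i, j} = {k, k + 1})
              \<or> {i, j} = {n - 2, n} then - 1
      else 0)"

text \<open>Matrices are indexed from 0, hence the shift by one.\<close>

definition affine_cartan_D :: "nat \<Rightarrow> int mat" where
  "affine_cartan_D n = mat n n (\<lambda>(i, j). affine_cartan_D_entry n (i + 1) (j + 1))"

end

theory Submission
  imports Defs
begin

text \<open>
  Put \<open>y = x - 2\<close>. Since \<open>C = 2I - A\<close> with \<open>A\<close> the adjacency matrix of the Dynkin diagram, the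
  characteristic matrix of \<open>C\<close> is \<open>yI + A\<close>. The diagram is a path with two leaves attached at
  each end, so its determinant can be computed by removing leaves.

  With the vertices numbered as in the Cartan matrix, each of the vertices \<open>4, \<dots>, n - 1\<close> is joined
  to its predecessor and to no other earlier vertex, so the leading principal minors \<open>d\<^sub>l\<close> of size \<open>l + 2\<close> satisfy
  \<open>d\<^sub>l\<^sub>+\<^sub>2 = y d\<^sub>l\<^sub>+\<^sub>1 - d\<^sub>l\<close> (lemma \<open>leading_minor_path_step\<close>) up to size \<open>n - 1\<close>. The first fork
  only enters through the initial values \<open>d\<^sub>0 = y\<^sup>2\<close> and \<open>d\<^sub>1 = y\<^sup>3 - 2y\<close>. The last vertex is a
  second leaf at vertex \<open>n - 2\<close>; removing it and its twin (lemma \<open>leading_minor_fork\<close>) gives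
  \<open>p\<^sub>n = y (y d\<^sub>n\<^sub>-\<^sub>4 - 2 d\<^sub>n\<^sub>-\<^sub>5)\<close>.

  The combination \<open>y d\<^sub>k\<^sub>+\<^sub>1 - 2 d\<^sub>k\<close> obeys the same linear recurrence as the \<open>d\<^sub>l\<close>, which is
  also that of the Chebyshev polynomials of the second kind at \<open>y/2\<close>. Comparing two initial values
  identifies it with \<open>y (y\<^sup>2 - 4) U\<^sub>k\<^sub>+\<^sub>1(y/2)\<close> (lemma \<open>fork_combination_eq_shifted_cheb\<close>). Here
  \<open>y\<^sup>2 - 4 = x (x - 4)\<close>, and expanding \<open>U\<^sub>n\<^sub>-\<^sub>4((x - 2)/2)\<close> in powers of \<open>x\<close> produces the binomial sum:
  for its coefficients the recurrence is a second-difference form of Pascal's rule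
  (lemma \<open>shifted_cheb_rec\<close>).
\<close>

section \<open>Removing leaves from leading principal minors\<close>

text \<open>
  Entries are given by a function on all pairs of naturals, so that submatrices of every size come
  from reindexing one function and no dimension side conditions arise.
\<close>

definition leading_minor :: "(nat \<Rightarrow> nat \<Rightarrow> 'a :: comm_ring_1) \<Rightarrow> nat \<Rightarrow> 'a" where
  "leading_minor f n = det (mat n n (\<lambda>(i, j). f i j))"

lemma leading_minor_cong:
  assumes "\<And>i j. i < n \<Longrightarrow> j < n \<Longrightarrow> f i j = g i j"
  shows "leading_minor f n = leading_minor g n"
proof -
  have "mat n n (\<lambda>(i, j). f i j) = mat n n (\<lambda>(i, j). g i j)"
    by (rule eq_matI) (auto simp: assms)
  then show ?thesis by (simp add: leading_minor_def)
qed

lemma leading_minor_0: "leading_minor f 0 = 1"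
  by (simp add: leading_minor_def det_def)

lemma leading_minor_last_row:
  "leading_minor f (Suc n) =
    (\<Sum>k\<le>n. f n k * ((- 1) ^ (n + k) * leading_minor (\<lambda>i j. f i (if j < k then j else Suc j)) n))"
proof -
  let ?A = "mat (Suc n) (Suc n) (\<lambda>(i, j). f i j)"
  have "mat_delete ?A n k = mat n n (\<lambda>(i, j). f i (if j < k then j else Suc j))" if "k \<le> n" for k
    using that by (intro eq_matI) (auto simp: mat_delete_def)
  then have "cofactor ?A n k = (- 1) ^ (n + k) * leading_minor (\<lambda>i j. f i (if j < k then j else Suc j)) n"
    if "k \<le> n" for k
    using that by (simp add: cofactor_def leading_minor_def)
  moreover have "leading_minor f (Suc n) = (\<Sum>k<Suc n. ?A $$ (n, k) * cofactor ?A n k)"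
    unfolding leading_minor_def by (rule laplace_expansion_row) auto
  ultimately show ?thesis
    by (simp add: lessThan_Suc_atMost)
qed

lemma leading_minor_transpose: "leading_minor (\<lambda>i j. f j i) n = leading_minor f n"
proof -
  have "mat n n (\<lambda>(i, j). f j i) = transpose_mat (mat n n (\<lambda>(i, j). f i j))"
    by (rule eq_matI) auto
  then show ?thesis
    by (simp add: leading_minor_def det_transpose[of _ n])
qed

lemma leading_minor_last_row_single:
  assumes "k \<le> n" and "\<And>j. j \<le> n \<Longrightarrow> j \<noteq> k \<Longrightarrow> f n j = 0"
  shows "leading_minor f (Suc n) =
    (- 1) ^ (n + k) * f n k * leading_minor (\<lambda>i j. f i (if j < k then j else Suc j)) n"
proof -
  have "leading_minor f (Suc n) = (\<Sum>j\<in>{k}. f n j * ((- 1) ^ (n + j) *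
      leading_minor (\<lambda>i l. f i (if l < j then l else Suc l)) n))"
    unfolding leading_minor_last_row by (rule sum.mono_neutral_right) (use assms in auto)
  then show ?thesis by simp
qed

lemma leading_minor_last_row_two:
  assumes "k < n" and "\<And>j. j < n \<Longrightarrow> j \<noteq> k \<Longrightarrow> f n j = 0"
  shows "leading_minor f (Suc n) = f n n * leading_minor f n +
    (- 1) ^ (n + k) * f n k * leading_minor (\<lambda>i j. f i (if j < k then j else Suc j)) n"
proof -
  have "leading_minor f (Suc n) = (\<Sum>j\<in>{k, n}. f n j * ((- 1) ^ (n + j) *
      leading_minor (\<lambda>i l. f i (if l < j then l else Suc l)) n))"
    unfolding leading_minor_last_row by (rule sum.mono_neutral_right) (use assms in auto)
  moreover have "leading_minor (\<lambda>i l. f i (if l < n then l else Suc l)) n = leading_minor f n"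
    by (rule leading_minor_cong) auto
  ultimately show ?thesis using assms(1)
    by (simp flip: mult_2)
qed

lemma leading_minor_last_col_single:
  assumes "\<And>i. i < n \<Longrightarrow> f i n = 0"
  shows "leading_minor f (Suc n) = f n n * leading_minor f n"
proof -
  have "leading_minor f (Suc n) = leading_minor (\<lambda>i j. f j i) (Suc n)"
    by (rule leading_minor_transpose [symmetric])
  also have "\<dots> = f n n * leading_minor (\<lambda>i j. f (if j < n then j else Suc j) i) n"
    using leading_minor_last_row_single[of n n "\<lambda>i j. f j i"] assms by (simp flip: mult_2)
  also have "leading_minor (\<lambda>i j. f (if j < n then j else Suc j) i) n =
      leading_minor (\<lambda>i j. f j i) n"
    by (rule leading_minor_cong) auto
  also have "\<dots> = leading_minor f n"
    by (rule leading_minor_transpose)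
  finally show ?thesis .
qed

text \<open>
  Vertex \<open>n + 1\<close> is a leaf attached to vertex \<open>n\<close>: expanding along its row leaves, besides the
  diagonal term, a minor whose last column has \<open>f n (n + 1)\<close> as its only nonzero entry.
\<close>

lemma leading_minor_path_step:
  assumes row: "\<And>j. j < n \<Longrightarrow> f (Suc n) j = 0"
    and col: "\<And>i. i < n \<Longrightarrow> f i (Suc n) = 0"
  shows "leading_minor f (Suc (Suc n)) = f (Suc n) (Suc n) * leading_minor f (Suc n)
    - f (Suc n) n * f n (Suc n) * leading_minor f n"
proof -
  let ?g = "\<lambda>i j. f i (if j < n then j else Suc j)"
  have "leading_minor f (Suc (Suc n)) = f (Suc n) (Suc n) * leading_minor f (Suc n)
      - f (Suc n) n * leading_minor ?g (Suc n)"
    by (subst leading_minor_last_row_two[of n]) (use row in auto)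
  also have "leading_minor ?g (Suc n) = f n (Suc n) * leading_minor ?g n"
    by (subst leading_minor_last_col_single) (use col in auto)
  also have "leading_minor ?g n = leading_minor f n"
    by (rule leading_minor_cong) auto
  finally show ?thesis by (simp add: mult.assoc)
qed

text \<open>
  Vertices \<open>h + 1\<close> and \<open>h + 2\<close> are twin leaves at vertex \<open>h\<close>. Deleting row \<open>h + 2\<close> and column \<open>h\<close>
  removes the only off-diagonal entry of row \<open>h + 1\<close>, so the twin splits off with its diagonal
  entry. What remains has \<open>f h (h + 2)\<close> as the only nonzero entry of its last column.
\<close>

lemma leading_minor_fork:
  assumes row2: "\<And>j. j < h + 2 \<Longrightarrow> j \<noteq> h \<Longrightarrow> f (h + 2) j = 0"
    and col2: "\<And>i. i < h \<Longrightarrow> f i (h + 2) = 0"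
    and row1: "\<And>j. j < h + 3 \<Longrightarrow> j \<noteq> h \<Longrightarrow> j \<noteq> h + 1 \<Longrightarrow> f (h + 1) j = 0"
  shows "leading_minor f (h + 3) = f (h + 2) (h + 2) * leading_minor f (h + 2)
    - f (h + 2) h * f h (h + 2) * f (h + 1) (h + 1) * leading_minor f h"
proof -
  let ?g = "\<lambda>i j. f i (if j < h then j else Suc j)"
  let ?k = "\<lambda>i j. ?g i (if j < h then j else Suc j)"
  have "leading_minor f (Suc (h + 2)) = f (h + 2) (h + 2) * leading_minor f (h + 2)
      + f (h + 2) h * leading_minor ?g (Suc (Suc h))"
    by (subst leading_minor_last_row_two[of h]) (use row2 in auto)
  also have "leading_minor ?g (Suc (Suc h)) = - f (h + 1) (h + 1) * leading_minor ?k (Suc h)"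
    by (subst leading_minor_last_row_single[of h]) (use row1 in auto)
  also have "leading_minor ?k (Suc h) = f h (h + 2) * leading_minor ?k h"
    by (subst leading_minor_last_col_single) (use col2 in auto)
  also have "leading_minor ?k h = leading_minor f h"
    by (rule leading_minor_cong) auto
  finally show ?thesis by (simp add: algebra_simps numeral_3_eq_3)
qed

section \<open>Chebyshev polynomials\<close>

text \<open>
  This is the Chebyshev polynomial of the second kind \<open>U\<^sub>m\<close> at \<open>(x - 2)/2\<close>, expanded in powers
  of \<open>x\<close>.
\<close>

definition shifted_cheb :: "nat \<Rightarrow> int poly" where
  "shifted_cheb m = (\<Sum>j\<le>m. monom ((- 1) ^ (m + j) * int ((m + j + 1) choose (2 * j + 1))) j)"

lemma coeff_shifted_cheb:
  "coeff (shifted_cheb m) j = (- 1) ^ (m + j) * int ((m + j + 1) choose (2 * j + 1))"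
  \<comment> \<open>For \<open>j > m\<close> the binomial coefficient vanishes, so the degree bound can be dropped.\<close>
  by (auto simp: shifted_cheb_def coeff_sum binomial_eq_0)

lemma binomial_second_difference:
  "(Suc (Suc a) choose Suc (Suc b)) + (a choose Suc (Suc b)) =
    (a choose b) + 2 * (Suc a choose Suc (Suc b))"
  by simp

lemma shifted_cheb_rec:
  "shifted_cheb (Suc (Suc m)) = [:- 2, 1:] * shifted_cheb (Suc m) - shifted_cheb m"
proof (rule poly_eqI)
  fix j
  show "coeff (shifted_cheb (Suc (Suc m))) j =
      coeff ([:- 2, 1:] * shifted_cheb (Suc m) - shifted_cheb m) j"
  proof (cases j)
    case 0
    then show ?thesis
      by (simp add: coeff_shifted_cheb algebra_simps)
  next
    case (Suc i)
    let ?a = "m + i + 2"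
    have "int (Suc (Suc ?a) choose Suc (Suc (2 * i + 1))) + int (?a choose Suc (Suc (2 * i + 1))) =
        int (?a choose (2 * i + 1)) + 2 * int (Suc ?a choose Suc (Suc (2 * i + 1)))"
      using binomial_second_difference[of ?a "2 * i + 1"] by linarith
    then have "(- 1) ^ (m + i) * int (Suc (Suc ?a) choose Suc (Suc (2 * i + 1))) =
       (- 1) ^ (m + i) * (int (?a choose (2 * i + 1)) + 2 * int (Suc ?a choose Suc (Suc (2 * i + 1)))
         - int (?a choose Suc (Suc (2 * i + 1))))"
      by simp
    then show ?thesis unfolding Suc
      by (simp add: coeff_shifted_cheb algebra_simps del: binomial_Suc_Suc)
  qed
qed

lemma shifted_cheb_1: "shifted_cheb (Suc 0) = [:- 2, 1:]"
  by (rule poly_eqI) (auto simp: coeff_shifted_cheb coeff_pCons binomial_eq_0 numeral_eq_Suc split: nat.splits)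

lemma shifted_cheb_0: "shifted_cheb 0 = 1"
  by (rule poly_eqI) (auto simp: coeff_shifted_cheb binomial_eq_0)

text \<open>
  Both sides satisfy the same second-order linear recurrence in \<open>k\<close>, so it suffices to compare
  them for \<open>k = 0\<close> and \<open>k = 1\<close>. The recurrence for \<open>d\<close> is only assumed up to a bound \<open>m\<close> because
  the path of a finite diagram ends, where the second fork begins.
\<close>

lemma fork_combination_eq_shifted_cheb:
  fixes d :: "nat \<Rightarrow> int poly"
  defines "y \<equiv> [:- 2, 1:]"
  assumes d0: "d 0 = y ^ 2" and d1: "d 1 = y ^ 3 - 2 * y"
    and rec: "\<And>k. Suc (Suc k) \<le> m \<Longrightarrow> d (Suc (Suc k)) = y * d (Suc k) - d k"
    and "Suc k \<le> m"
  shows "y * d (Suc k) - 2 * d k = y * (y ^ 2 - 4) * shifted_cheb (Suc k)"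
  using \<open>Suc k \<le> m\<close>
proof (induction k rule: less_induct)
  case (less k)
  consider "k = 0" | "k = 1" | l where "k = Suc (Suc l)"
    by (metis One_nat_def not0_implies_Suc)
  then show ?case
  proof cases
    case 1
    then show ?thesis
      using d0 d1 by (simp add: shifted_cheb_1 flip: y_def) (simp add: algebra_simps eval_nat_numeral)
  next
    case 2
    have "d 2 = y * d 1 - d 0"
      using rec[of 0] less.prems 2 by (simp add: numeral_2_eq_2)
    then show ?thesis
      using d0 d1 2 by (simp add: shifted_cheb_rec shifted_cheb_1 shifted_cheb_0 numeral_2_eq_2 flip: y_def)
        (simp add: algebra_simps eval_nat_numeral)
  next
    case (3 l)
    have "y * d (Suc k) - 2 * d k =
        y * (y * d (Suc (Suc l)) - 2 * d (Suc l)) - (y * d (Suc l) - 2 * d l)"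
      using less.prems unfolding 3 by (simp add: rec) (simp add: algebra_simps)
    also have "\<dots> = y * (y * (y ^ 2 - 4) * shifted_cheb (Suc (Suc l))) 
        - y * (y ^ 2 - 4) * shifted_cheb (Suc l)"
      using less.IH[of l] less.IH[of "Suc l"] less.prems 3 by simp
    also have "\<dots> = y * (y ^ 2 - 4) * shifted_cheb (Suc k)"
      by (simp add: 3 shifted_cheb_rec[of "Suc l"] right_diff_distrib flip: y_def)
    finally show ?thesis .
  qed
qed

section \<open>The affine Cartan matrix\<close>

definition affine_D_char_entry :: "nat \<Rightarrow> nat \<Rightarrow> nat \<Rightarrow> int poly" where
  "affine_D_char_entry n i j =
    (if i = j then [:- 2, 1:] else [:- affine_cartan_D_entry n (i + 1) (j + 1):])"

lemma char_poly_affine_cartan_D: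
  "char_poly (affine_cartan_D n) = leading_minor (affine_D_char_entry n) n"
proof -
  have "char_poly_matrix (affine_cartan_D n) = mat n n (\<lambda>(i, j). affine_D_char_entry n i j)"
    by (rule eq_matI)
      (auto simp: char_poly_matrix_def affine_cartan_D_def affine_D_char_entry_def
        affine_cartan_D_entry_def)
  then show ?thesis
    by (simp add: char_poly_def leading_minor_def)
qed

text \<open>
  Counted from 0, the edges are \<open>{0, 2}\<close>, the path from \<open>1\<close> to \<open>n - 2\<close>, and \<open>{n - 3, n - 1}\<close>. Stating
  them by arithmetic conditions on an ordered pair, without doubletons or truncated subtraction,
  lets the simplifier evaluate entries.
\<close>

lemma affine_D_char_entry_less:
  assumes "i < j"
  shows "affine_D_char_entry n i j =
      (if i = 0 \<and> j = 2 \<or> 1 \<le> i \<and> j = i + 1 \<and> j + 2 \<le> n \<or> n \<ge> 3 \<and> i + 3 = n \<and> j + 1 = n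
       then 1 else 0)" (is ?A)
  and "affine_D_char_entry n j i = affine_D_char_entry n i j"
proof -
  have "(\<exists>k. 2 \<le> k \<and> k \<le> n - 2 \<and> {i + 1, j + 1} = {k, k + 1}) \<longleftrightarrow> 1 \<le> i \<and> j = i + 1 \<and> j + 2 \<le> n"
    using assms by (auto simp: doubleton_eq_iff intro!: exI[of _ "i + 1"])
  moreover have "{i + 1, j + 1} = {1, 3} \<longleftrightarrow> i = 0 \<and> j = 2"
    and "{i + 1, j + 1} = {n - 2, n} \<longleftrightarrow> n \<ge> 3 \<and> i + 3 = n \<and> j + 1 = n"
    using assms by (auto simp: doubleton_eq_iff)
  ultimately show ?A
    using assms unfolding affine_D_char_entry_def affine_cartan_D_entry_def by (auto simp: pCons_one)
  show "affine_D_char_entry n j i = affine_D_char_entry n i j"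
    using assms by (auto simp: affine_D_char_entry_def affine_cartan_D_entry_def insert_commute)
qed

theorem proposition4:
  fixes n :: nat
  assumes "n \<ge> 5"
  shows "char_poly (affine_cartan_D n) =
    [:0, 1:] * [:- 2, 1:] ^ 2 * [:- 4, 1:] *
      (\<Sum>j = 0..n - 4. monom ((- 1) ^ (n + j) * int ((n + j - 3) choose (2 * j + 1))) j)"
proof -
  define y :: "int poly" where "y = [:- 2, 1:]"
  obtain k where n: "n = k + 5"
    using assms by (metis le_add_diff_inverse2)
  let ?f = "affine_D_char_entry n"
  define d where "d l = leading_minor ?f (l + 2)" for l
  have diag: "affine_D_char_entry m i i = y" for m i
    by (simp add: affine_D_char_entry_def y_def)
  note entries = affine_D_char_entry_less n diag
  have m1: "leading_minor ?f 1 = y"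
    using leading_minor_last_row[of ?f 0] by (simp add: leading_minor_0 diag)
  have d0: "d 0 = y ^ 2"
    using leading_minor_path_step[of 0 ?f] m1
    by (simp add: d_def entries numeral_2_eq_2 leading_minor_0)
  have d1: "d 1 = y ^ 3 - 2 * y"
    by (simp add: d_def entries leading_minor_last_row leading_minor_0 numeral_eq_Suc algebra_simps)
  have rec: "d (Suc (Suc l)) = y * d (Suc l) - d l" if "Suc (Suc l) \<le> Suc (Suc k)" for l
    using leading_minor_path_step[of "l + 2" ?f] that
    by (simp add: d_def entries)
  \<comment> \<open>Row \<open>k + 3 = n - 2\<close> belongs to the first of the two leaves of the second fork.\<close>
  have leaf_row: "affine_D_char_entry (k + 5) (Suc (Suc (Suc k))) j = 0"
    if "j < k + 5" "j \<noteq> Suc (Suc k)" "j \<noteq> Suc (Suc (Suc k))" for j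
    using that by (cases j "Suc (Suc (Suc k))" rule: linorder_cases) (auto simp: entries)
  \<comment> \<open>The twin leaf at the hub \<open>k + 2 = n - 3\<close> splits off; the minor of size \<open>n - 1\<close> is \<open>d (k + 2)\<close>.\<close>
  have "char_poly (affine_cartan_D n) = y * (y * d (Suc k) - d k) - y * d k"
    using leading_minor_fork[of "k + 2" ?f] rec[of k]
    by (simp add: char_poly_affine_cartan_D d_def entries n leaf_row add.commute[of 5])
  also have "\<dots> = y * (y * d (Suc k) - 2 * d k)"
    by (simp add: algebra_simps)
  also have "\<dots> = y * (y * (y ^ 2 - 4) * shifted_cheb (Suc k))"
    using fork_combination_eq_shifted_cheb[of d "Suc (Suc k)" k] d0 d1 rec by (simp add: y_def)
  also have "\<dots> = [:0, 1:] * [:- 2, 1:] ^ 2 * [:- 4, 1:] * shifted_cheb (Suc k)"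
  proof -
    have "y ^ 2 - 4 = [:0, 1:] * [:- 4, 1:]"
      by (simp add: y_def power2_eq_square numeral_poly)
    then show ?thesis
      by (simp only: power2_eq_square y_def ac_simps)
  qed
  also have "shifted_cheb (Suc k) =
      (\<Sum>j = 0..n - 4. monom ((- 1) ^ (n + j) * int ((n + j - 3) choose (2 * j + 1))) j)"
    unfolding shifted_cheb_def n atMost_atLeast0
    by (intro sum.cong arg_cong2[where f = monom]) (auto simp: numeral_eq_Suc)
  finally show ?thesis .
qed

end
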